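(* Let $H$ be an $r$-uniform hypergraph on $n$ vertices and $k\ge1$ an integer. Then $f(H,1,k)\ge \chi(H)-r(r(k-1)+1)$. For $r=2$ this bound is sharp: there are graphs attaining equality.
   Context: $\chi(H)$ is the chromatic number of $H$: the minimum number of colors in a vertex coloring with no monochromatic edge. An orientation $D$ of $H$ assigns to each edge a linear ordering of its $r$ vertices (positions $1,\dots,r$); $\deg_i(v)$ is the number of edges in which $v$ occupies position $i$. $f(H,1,k)$ is the minimum over all orientations of the number of vertices $v$ with $\deg_i(v)\ge k$ for all $1\le i\le r$. *)

theory Defs
  imports Main
begin

(* A hypergraph is given by its vertex set V and its set E of edges; a graph is the case r = 2. *)

definition uniform_hypergraph :: "nat \<Rightarrow> 'a set \<Rightarrow> 'a set set \<Rightarrow> bool" where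
  "uniform_hypergraph r V E \<longleftrightarrow> finite V \<and> (\<forall>e\<in>E. e \<subseteq> V \<and> card e = r)"

definition monochromatic :: "('a \<Rightarrow> nat) \<Rightarrow> 'a set \<Rightarrow> bool" where
  "monochromatic c e \<longleftrightarrow> (\<exists>x. \<forall>v\<in>e. c v = x)"

definition proper_coloring :: "'a set \<Rightarrow> 'a set set \<Rightarrow> nat \<Rightarrow> ('a \<Rightarrow> nat) \<Rightarrow> bool" where
  "proper_coloring V E m c \<longleftrightarrow> c ` V \<subseteq> {..<m} \<and> (\<forall>e\<in>E. \<not> monochromatic c e)"

(* Meaningful only if a proper coloring exists. For a finite V this is the case as soon as
   every edge has at least two vertices. *)
definition chromatic_number :: "'a set \<Rightarrow> 'a set set \<Rightarrow> nat" where
  "chromatic_number V E = (LEAST m. \<exists>c. proper_coloring V E m c)"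

(* A linear ordering of an edge e is encoded as its enumeration: D e i is the vertex in
   position i, for 1 \<le> i \<le> r. Values of D elsewhere are irrelevant. *)
definition orientation :: "nat \<Rightarrow> 'a set set \<Rightarrow> ('a set \<Rightarrow> nat \<Rightarrow> 'a) \<Rightarrow> bool" where
  "orientation r E D \<longleftrightarrow> (\<forall>e\<in>E. bij_betw (D e) {1..r} e)"

definition pos_degree :: "'a set set \<Rightarrow> ('a set \<Rightarrow> nat \<Rightarrow> 'a) \<Rightarrow> nat \<Rightarrow> 'a \<Rightarrow> nat" where
  "pos_degree E D i v = card {e \<in> E. D e i = v}"

(* The quantity f(H,1,k) of an r-uniform hypergraph H = (V, E). *)
definition f_one :: "nat \<Rightarrow> 'a set \<Rightarrow> 'a set set \<Rightarrow> nat \<Rightarrow> nat" where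
  "f_one r V E k =
    (LEAST m. \<exists>D. orientation r E D \<and>
       m = card {v \<in> V. \<forall>i\<in>{1..r}. k \<le> pos_degree E D i v})"

end

(* Lower bound: fix an orientation and let S be the set of vertices all of whose position degrees
   are at least k. Every other vertex v has a position i with deg_i(v) < k; let W_i be the set of
   vertices assigned to position i. Charging each edge inside a set W \<subseteq> W_i to its vertex in
   position i shows that W spans at most (k - 1)|W| edges, so W_i spans an r(k - 1)-degenerate
   hypergraph and is greedily coloured with r(k - 1) + 1 colours. Use disjoint palettes for the r
   classes and a private colour for each vertex of S.

   Sharpness: two disjoint regular tournaments on 2k - 1 vertices, with all edges between them
   directed from the first to the second, orient the complete graph on 4k - 2 vertices so that every
   vertex has in-degree or out-degree k - 1. *)
theory Submission
  imports Defs
begin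

section \<open>Greedy colouring of degenerate hypergraphs\<close>

text \<open>Double counting: the degrees in \<open>F\<close> sum to \<open>r * card F\<close>, and
  charging each edge \<open>e\<close> to \<open>h e\<close> gives
  \<open>card F \<le> card W * d\<close>. So the average degree is at most
  \<open>r * d\<close>.\<close>

lemma exists_low_degree_vertex:
  fixes h :: "'a set \<Rightarrow> 'a"
  assumes "finite W" "W \<noteq> {}" "finite F"
    and edges: "\<And>e. e \<in> F \<Longrightarrow> e \<subseteq> W \<and> card e = r \<and> h e \<in> e"
    and fibres: "\<And>v. v \<in> W \<Longrightarrow> card {e \<in> F. h e = v} \<le> d"
  shows "\<exists>v\<in>W. card {e \<in> F. v \<in> e} \<le> r * d"
proof (rule ccontr)
  assume "\<not> ?thesis"
  then have "(\<Sum>v\<in>W. r * d) < (\<Sum>v\<in>W. card {e \<in> F. v \<in> e})"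
    using assms(1,2) by (intro sum_strict_mono) auto
  moreover have "(\<Sum>v\<in>W. card {e \<in> F. v \<in> e}) = r * card F"
  proof (rule sum_multicount[OF \<open>finite W\<close> \<open>finite F\<close>], intro ballI)
    fix e assume "e \<in> F"
    with edges have "{v \<in> W. v \<in> e} = e" by blast
    then show "card {v \<in> W. v \<in> e} = r" using edges \<open>e \<in> F\<close> by simp
  qed
  moreover have "card F \<le> card W * d"
  proof -
    have "F = (\<Union>v\<in>W. {e \<in> F. h e = v})" using edges by blast
    then have "card F \<le> (\<Sum>v\<in>W. card {e \<in> F. h e = v})"
      using card_UN_le[OF \<open>finite W\<close>] by metis
    also have "\<dots> \<le> card W * d" using sum_bounded_above[OF fibres] by simp
    finally show ?thesis .
  qed
  then have "r * card F \<le> (\<Sum>v\<in>W. r * d)"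
    using mult_le_mono2[of "card F" "card W * d" r] by (simp add: ac_simps)
  ultimately show False by simp
qed

text \<open>Induction on \<open>W\<close>: delete a vertex of low degree, colour the rest, put the
  vertex back. The fibres of \<open>h\<close> are counted in all of \<open>E\<close>, so every
  subset of \<open>W\<close> inherits their bound.\<close>

lemma degenerate_coloring:
  fixes h :: "'a set \<Rightarrow> 'a"
  assumes "finite W" "finite E" "r \<ge> 2"
    and edges: "\<And>e. e \<in> E \<Longrightarrow> card e = r \<and> h e \<in> e"
    and "\<And>v. v \<in> W \<Longrightarrow> card {e \<in> E. h e = v} \<le> d"
  shows "\<exists>c. proper_coloring W {e \<in> E. e \<subseteq> W} (r * d + 1) c"
  using assms(1,5)
proof (induction W rule: finite_psubset_induct)
  case (psubset W)
  define F where "F = {e \<in> E. e \<subseteq> W}"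
  show ?case
  proof (cases "W = {}")
    case True
    then have "F = {}" using edges \<open>r \<ge> 2\<close> unfolding F_def by fastforce
    then show ?thesis using True by (simp add: proper_coloring_def F_def)
  next
    case False
    have "\<exists>v\<in>W. card {e \<in> F. v \<in> e} \<le> r * d"
    proof (rule exists_low_degree_vertex[where h = h])
      fix v assume "v \<in> W"
      have "card {e \<in> F. h e = v} \<le> card {e \<in> E. h e = v}"
        using \<open>finite E\<close> by (intro card_mono) (auto simp: F_def)
      then show "card {e \<in> F. h e = v} \<le> d" using psubset.prems[OF \<open>v \<in> W\<close>] by simp
    qed (use psubset.hyps False \<open>finite E\<close> edges in \<open>auto simp: F_def\<close>)
    then obtain v where v: "v \<in> W" "card {e \<in> F. v \<in> e} \<le> r * d" by blast
    obtain c where c: "proper_coloring (W - {v}) {e \<in> E. e \<subseteq> W - {v}} (r * d + 1) c"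
      using psubset.IH[of "W - {v}"] psubset.prems v by auto
    \<comment> \<open>The colouring \<open>c\<close> promises nothing about edges through
      \<open>v\<close>. One further vertex \<open>u e\<close> suffices: if \<open>v\<close> avoids
      the colour of \<open>u e\<close>, the edge is not monochromatic. So each edge through
      \<open>v\<close> forbids just one colour.\<close>
    have "\<exists>u\<in>e. u \<noteq> v" if "e \<in> E" for e
    proof (rule ccontr)
      assume "\<not> ?thesis"
      then have "card e \<le> card {v}" by (intro card_mono) auto
      then show False using edges that \<open>r \<ge> 2\<close> by fastforce
    qed
    then obtain u where u: "\<And>e. e \<in> E \<Longrightarrow> u e \<in> e \<and> u e \<noteq> v" by metis
    define B where "B = (\<lambda>e. c (u e)) ` {e \<in> F. v \<in> e}"
    have "finite B" and "card B \<le> r * d"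
      using card_image_le[of "{e \<in> F. v \<in> e}" "\<lambda>e. c (u e)"] v \<open>finite E\<close>
      by (auto simp: B_def F_def)
    \<comment> \<open>At most \<open>r * d\<close> of the \<open>r * d + 1\<close> colours are
      forbidden.\<close>
    then obtain x where x: "x < r * d + 1" "x \<notin> B"
      using card_mono[of B "{..<r * d + 1}"] by fastforce
    have "proper_coloring W F (r * d + 1) (c(v := x))"
      unfolding proper_coloring_def
    proof (intro conjI ballI notI)
      show "c(v := x) ` W \<subseteq> {..<r * d + 1}"
        using c x by (auto simp: proper_coloring_def)
      fix e assume "e \<in> F" and mono: "monochromatic (c(v := x)) e"
      show False
      proof (cases "v \<in> e")
        case True
        have "u e \<in> e" "u e \<noteq> v" using u \<open>e \<in> F\<close> by (auto simp: F_def)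
        then have "c (u e) = x" using mono True unfolding monochromatic_def by (metis fun_upd_apply)
        then show False using x True \<open>e \<in> F\<close> by (auto simp: B_def)
      next
        case False
        then have "monochromatic c e" using mono unfolding monochromatic_def by (metis fun_upd_apply)
        then show False using c False \<open>e \<in> F\<close> by (auto simp: proper_coloring_def F_def)
      qed
    qed
    then show ?thesis unfolding F_def by blast
  qed
qed

section \<open>Disjoint palettes and the bound for a fixed orientation\<close>

lemma chromatic_number_le: "proper_coloring V E m c \<Longrightarrow> chromatic_number V E \<le> m"
  unfolding chromatic_number_def by (rule Least_le) blast

text \<open>Class \<open>i\<close> uses the colours from \<open>i * q\<close> to
  \<open>(i + 1) * q - 1\<close>, and \<open>S\<close> gets distinct colours from
  \<open>r * q\<close> on. A monochromatic edge thus lies in one class, contradicting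
  \<open>col\<close>, or in \<open>S\<close>, contradicting injectivity of \<open>g\<close>.\<close>

lemma proper_coloring_union_palettes:
  fixes p :: "'a \<Rightarrow> nat" and col :: "nat \<Rightarrow> 'a \<Rightarrow> nat"
  assumes "S \<subseteq> V" "finite V"
    and edges: "\<And>e. e \<in> E \<Longrightarrow> e \<subseteq> V \<and> card e \<ge> 2"
    and p: "\<And>v. v \<in> V - S \<Longrightarrow> p v < r"
    and col: "\<And>i. i < r \<Longrightarrow>
      proper_coloring {v \<in> V - S. p v = i} {e \<in> E. e \<subseteq> {v \<in> V - S. p v = i}} q (col i)"
  shows "\<exists>c. proper_coloring V E (r * q + card S) c"
proof -
  have "finite S" using assms(1,2) finite_subset by blast
  then obtain g where g: "bij_betw g S {..<card S}"
    using ex_bij_betw_finite_nat[of S] by (auto simp: atLeast0LessThan)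
  define c where "c v = (if v \<in> S then r * q + g v else p v * q + col (p v) v)" for v
  have colq: "col (p v) v < q" if "v \<in> V - S" for v
    using col[OF p[OF that]] that by (auto simp: proper_coloring_def)
  have low: "c v < r * q" if "v \<in> V - S" for v
  proof -
    have "c v < (p v + 1) * q" using colq[OF that] that by (simp add: c_def)
    also have "\<dots> \<le> r * q" using p[OF that] by (intro mult_le_mono1) simp
    finally show ?thesis .
  qed
  have high: "c v = r * q + g v" "g v < card S" if "v \<in> S" for v
    using g that by (auto simp: c_def bij_betw_def)
  have "proper_coloring V E (r * q + card S) c"
    unfolding proper_coloring_def
  proof (intro conjI ballI notI)
    show "c ` V \<subseteq> {..<r * q + card S}"
    proof (intro image_subsetI)
      fix v assume "v \<in> V"
      then show "c v \<in> {..<r * q + card S}"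
        using low[of v] high[of v] by (cases "v \<in> S") auto
    qed
    fix e assume e: "e \<in> E" and "monochromatic c e"
    then obtain x where x: "\<And>v. v \<in> e \<Longrightarrow> c v = x" by (auto simp: monochromatic_def)
    have eV: "e \<subseteq> V" and e2: "card e \<ge> 2" using edges[OF e] by auto
    show False
    proof (cases "x < r * q")
      case True
      then have eS: "e \<subseteq> V - S" using x high eV by fastforce
      \<comment> \<open>Quotient and remainder by \<open>q\<close> recover the class and the colour
        inside it, so a common colour forces a common class.\<close>
      have dm: "p v = x div q" "col (p v) v = x mod q" if "v \<in> e" for v
      proof -
        have v: "v \<in> V - S" using eS that by blast
        then have "x = p v * q + col (p v) v" using x[OF that] by (simp add: c_def)
        then show "p v = x div q" "col (p v) v = x mod q" using colq[OF v] by simp_all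
      qed
      obtain w where "w \<in> e" using e2 by fastforce
      then have "x div q < r" using dm(1) p eS by (metis subsetD)
      moreover have "e \<subseteq> {v \<in> V - S. p v = x div q}" using dm eS by auto
      moreover have "monochromatic (col (x div q)) e"
        using dm by (auto simp: monochromatic_def)
      ultimately show False using col e by (auto simp: proper_coloring_def)
    next
      case False
      then have "e \<subseteq> S" using x low eV by fastforce
      moreover from this have "inj_on g e" using g by (meson bij_betw_def inj_on_subset)
      moreover have "g ` e \<subseteq> {x - r * q}" using \<open>e \<subseteq> S\<close> x high(1) by fastforce
      ultimately have "card e \<le> card {x - r * q}" by (metis card_inj_on_le finite.emptyI finite_insert)
      then show False using e2 by simp
    qed
  qed
  then show ?thesis by blast
qed

lemma chromatic_number_le_rich_vertices:
  assumes "k \<ge> 1" "r \<ge> 2" "uniform_hypergraph r V E" "orientation r E D"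
  shows "chromatic_number V E
    \<le> r * (r * (k - 1) + 1) + card {v \<in> V. \<forall>i\<in>{1..r}. k \<le> pos_degree E D i v}"
proof -
  define S where "S = {v \<in> V. \<forall>i\<in>{1..r}. k \<le> pos_degree E D i v}"
  have finV: "finite V" and edges: "\<And>e. e \<in> E \<Longrightarrow> e \<subseteq> V \<and> card e = r"
    using assms(3) by (auto simp: uniform_hypergraph_def)
  have finE: "finite E" using finV edges by (intro finite_subset[of E "Pow V"]) auto
  \<comment> \<open>Palettes are numbered from 0 but positions from 1, hence the shift by
    \<open>Suc\<close>.\<close>
  have "\<exists>i<r. pos_degree E D (Suc i) v \<le> k - 1" if v: "v \<in> V - S" for v
  proof -
    obtain i where "i \<in> {1..r}" "pos_degree E D i v < k" using v by (auto simp: S_def not_le)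
    then show ?thesis by (intro exI[of _ "i - 1"]) auto
  qed
  then obtain p where p: "\<And>v. v \<in> V - S \<Longrightarrow> p v < r \<and> pos_degree E D (Suc (p v)) v \<le> k - 1"
    by metis
  define W where "W i = {v \<in> V - S. p v = i}" for i
  have "\<exists>c. proper_coloring (W i) {e \<in> E. e \<subseteq> W i} (r * (k - 1) + 1) c" if "i < r" for i
  proof (rule degenerate_coloring[where h = "\<lambda>e. D e (Suc i)"])
    show "finite (W i)" using finV by (simp add: W_def)
    show "card e = r \<and> D e (Suc i) \<in> e" if "e \<in> E" for e
      using assms(4) edges[OF that] that \<open>i < r\<close>
        bij_betwE[of "D e" "{1..r}" e, THEN bspec, of "Suc i"]
      by (simp add: orientation_def)
    show "card {e \<in> E. D e (Suc i) = v} \<le> k - 1" if "v \<in> W i" for v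
      using p[of v] that by (auto simp: W_def pos_degree_def)
  qed (use finE assms in auto)
  then obtain col where
    col: "\<And>i. i < r \<Longrightarrow> proper_coloring (W i) {e \<in> E. e \<subseteq> W i} (r * (k - 1) + 1) (col i)"
    by metis
  have "\<exists>c. proper_coloring V E (r * (r * (k - 1) + 1) + card S) c"
    by (rule proper_coloring_union_palettes[where p = p and col = col])
      (use finV edges p col \<open>r \<ge> 2\<close> in \<open>auto simp: S_def W_def\<close>)
  then show ?thesis using chromatic_number_le unfolding S_def by blast
qed

section \<open>Attainment of the minimum\<close>

lemma orientation_exists:
  assumes "uniform_hypergraph r V E"
  shows "\<exists>D. orientation r E D"
proof -
  have "\<exists>h. bij_betw h {1..r} e" if "e \<in> E" for e
    using assms that ex_bij_betw_nat_finite_1[of e]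
    by (auto simp: uniform_hypergraph_def intro: finite_subset)
  then show ?thesis unfolding orientation_def by metis
qed

text \<open>The \<open>LEAST\<close> ranges over a nonempty set because some orientation exists. A
  bound valid for every orientation therefore transfers to \<open>f_one\<close>.\<close>

lemma f_one_attained:
  assumes "uniform_hypergraph r V E"
  obtains D where "orientation r E D"
    "f_one r V E k = card {v \<in> V. \<forall>i\<in>{1..r}. k \<le> pos_degree E D i v}"
proof -
  have "\<exists>m D. orientation r E D \<and> m = card {v \<in> V. \<forall>i\<in>{1..r}. k \<le> pos_degree E D i v}"
    using orientation_exists[OF assms] by blast
  from LeastI_ex[OF this] show ?thesis using that unfolding f_one_def by blast
qed

section \<open>Sharpness: complete graphs and tournaments\<close>

lemma chromatic_number_complete_graph:
  "chromatic_number {..<n} {e. e \<subseteq> {..<n} \<and> card e = 2} = n"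
  unfolding chromatic_number_def
proof (rule Least_equality)
  show "\<exists>c. proper_coloring {..<n} {e. e \<subseteq> {..<n} \<and> card e = 2} n c"
    unfolding proper_coloring_def
  proof (intro exI[of _ id] conjI ballI notI)
    fix e assume e: "e \<in> {e. e \<subseteq> {..<n} \<and> card e = 2}" and "monochromatic id e"
    then obtain x where "e \<subseteq> {x}" by (auto simp: monochromatic_def)
    then have "card e \<le> card {x}" by (intro card_mono) auto
    then show False using e by simp
  qed simp
next
  fix m assume "\<exists>c. proper_coloring {..<n} {e. e \<subseteq> {..<n} \<and> card e = 2} m c"
  then obtain c where pc: "proper_coloring {..<n} {e. e \<subseteq> {..<n} \<and> card e = 2} m c" ..
  have c: "c ` {..<n} \<subseteq> {..<m}" using pc by (simp add: proper_coloring_def)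
  have proper: "\<not> monochromatic c e" if "e \<subseteq> {..<n}" "card e = 2" for e
    using pc that by (simp add: proper_coloring_def)
  \<comment> \<open>Any two vertices form an edge, so they receive different colours.\<close>
  have "inj_on c {..<n}"
  proof (rule inj_onI, rule ccontr)
    fix a b assume ab: "a \<in> {..<n}" "b \<in> {..<n}" "c a = c b" "a \<noteq> b"
    have "\<not> monochromatic c {a, b}" by (rule proper) (use ab in simp_all)
    then show False using ab(3) unfolding monochromatic_def by blast
  qed
  then show "n \<le> m" using card_inj_on_le[OF _ c] by simp
qed

text \<open>Read \<open>P a b\<close> as \<open>a\<close> beats \<open>b\<close>: each edge gets a
  winner in position 1. \<open>P\<close> may hold both ways, and then one direction is chosen; this
  is why the degrees are only bounded from above.\<close>

lemma tournament_orientation: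
  fixes P :: "'a \<Rightarrow> 'a \<Rightarrow> bool"
  assumes "finite V"
    and total: "\<And>a b. a \<in> V \<Longrightarrow> b \<in> V \<Longrightarrow> a \<noteq> b \<Longrightarrow> P a b \<or> P b a"
  obtains D where "orientation 2 {e. e \<subseteq> V \<and> card e = 2} D"
    "\<And>v. pos_degree {e. e \<subseteq> V \<and> card e = 2} D 1 v \<le> card {b \<in> V. b \<noteq> v \<and> P v b}"
    "\<And>v. pos_degree {e. e \<subseteq> V \<and> card e = 2} D 2 v \<le> card {a \<in> V. a \<noteq> v \<and> P a v}"
proof -
  define E where "E = {e. e \<subseteq> V \<and> card e = 2}"
  have "\<exists>a b. e = {a, b} \<and> a \<noteq> b \<and> a \<in> V \<and> b \<in> V \<and> P a b" if e: "e \<in> E" for e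
  proof -
    obtain a b where ab: "e = {a, b}" "a \<noteq> b" using e by (auto simp: E_def card_2_iff)
    moreover have "a \<in> V" "b \<in> V" using e ab by (auto simp: E_def)
    ultimately show ?thesis using total[of a b] by (metis insert_commute)
  qed
  then obtain s t where
    st: "\<And>e. e \<in> E \<Longrightarrow> e = {s e, t e} \<and> s e \<noteq> t e \<and> s e \<in> V \<and> t e \<in> V \<and> P (s e) (t e)"
    by metis
  define D where "D e i = (if i = 1 then s e else t e)" for e and i :: nat
  have "{1..2} = {1, 2 :: nat}" by auto
  then have "bij_betw (D e) {1..2} e" if "e \<in> E" for e
    using st[OF that] by (auto simp: bij_betw_def D_def)
  then have "orientation 2 E D" by (simp add: orientation_def)
  moreover have "pos_degree E D 1 v \<le> card {b \<in> V. b \<noteq> v \<and> P v b}" for v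
    unfolding pos_degree_def
  \<comment> \<open>Once its first vertex is fixed, an edge is determined by its second one.\<close>
  proof (rule card_inj_on_le[where f = t])
    show "inj_on t {e \<in> E. D e 1 = v}"
      using st by (intro inj_onI) (metis (mono_tags, lifting) D_def mem_Collect_eq)
  qed (use st \<open>finite V\<close> in \<open>fastforce simp: D_def\<close>)+
  moreover have "pos_degree E D 2 v \<le> card {a \<in> V. a \<noteq> v \<and> P a v}" for v
    unfolding pos_degree_def
  proof (rule card_inj_on_le[where f = s])
    show "inj_on s {e \<in> E. D e 2 = v}"
    proof (rule inj_onI)
      fix e e' assume *: "e \<in> {e \<in> E. D e 2 = v}" "e' \<in> {e \<in> E. D e 2 = v}" "s e = s e'"
      then have "t e = t e'" by (simp add: D_def)
      then show "e = e'" using * st[of e] st[of e'] by simp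
    qed
  qed (use st \<open>finite V\<close> in \<open>fastforce simp: D_def\<close>)+
  ultimately show ?thesis using that unfolding E_def by blast
qed

(* On an odd number m of consecutive integers this is a regular tournament: counting cyclically,
   a beats a + 1, a + 3, ..., a + m - 2. *)
definition parity_beats :: "nat \<Rightarrow> nat \<Rightarrow> bool" where
  "parity_beats a b \<longleftrightarrow> (a < b \<longleftrightarrow> odd (a + b))"

text \<open>The beaten vertices lie at the cyclic offsets 1, 3, ..., \<open>2 * d - 1\<close> ahead
  of \<open>v\<close>, and \<open>?f\<close> enumerates these \<open>d\<close> places. As
  \<open>m\<close> is odd, an even distance backwards becomes an odd offset forwards.\<close>

lemma card_parity_beaten_by:
  assumes "m = 2 * d + 1" "l \<le> v" "v < l + m"
  shows "card {b \<in> {l..<l + m}. b \<noteq> v \<and> parity_beats v b} \<le> d"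
proof -
  let ?f = "\<lambda>j. if v + 2 * j + 1 < l + m then v + 2 * j + 1 else v + 2 * j + 1 - m"
  have "{b \<in> {l..<l + m}. b \<noteq> v \<and> parity_beats v b} \<subseteq> ?f ` {..<d}"
  proof
    fix b assume b: "b \<in> {b \<in> {l..<l + m}. b \<noteq> v \<and> parity_beats v b}"
    show "b \<in> ?f ` {..<d}"
    proof (cases "v < b")
      case True
      then have "odd (b - v)" using b by (simp add: parity_beats_def)
      then obtain j where "b - v = 2 * j + 1" by (elim oddE)
      then show ?thesis using b True assms by (intro image_eqI[of _ _ j]) auto
    next
      case False
      then have "even (v - b)" using b by (simp add: parity_beats_def)
      then obtain j where "v - b = 2 * j" by (elim evenE)
      \<comment> \<open>Going back \<open>2 * j\<close> is going forward
        \<open>m - 2 * j = 2 * (d - j) + 1\<close>, and \<open>j > 0\<close> because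
        \<open>b \<noteq> v\<close>.\<close>
      then show ?thesis using b False assms by (intro image_eqI[of _ _ "d - j"]) auto
    qed
  qed
  then have "card {b \<in> {l..<l + m}. b \<noteq> v \<and> parity_beats v b} \<le> card {..<d}"
    by (rule surj_card_le[OF finite_lessThan])
  then show ?thesis by simp
qed

text \<open>Mirror image of \<open>card_parity_beaten_by\<close>: the winners against
  \<open>v\<close> lie at the odd cyclic offsets behind it, and \<open>?f\<close> counts
  backwards.\<close>

lemma card_parity_beating:
  assumes "m = 2 * d + 1" "l \<le> v" "v < l + m"
  shows "card {a \<in> {l..<l + m}. a \<noteq> v \<and> parity_beats a v} \<le> d"
proof -
  let ?f = "\<lambda>j. if l + 2 * j + 1 \<le> v then v - (2 * j + 1) else v + m - (2 * j + 1)"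
  have "{a \<in> {l..<l + m}. a \<noteq> v \<and> parity_beats a v} \<subseteq> ?f ` {..<d}"
  proof
    fix a assume a: "a \<in> {a \<in> {l..<l + m}. a \<noteq> v \<and> parity_beats a v}"
    show "a \<in> ?f ` {..<d}"
    proof (cases "a < v")
      case True
      then have "odd (v - a)" using a by (simp add: parity_beats_def)
      then obtain j where "v - a = 2 * j + 1" by (elim oddE)
      then show ?thesis using a True assms by (intro image_eqI[of _ _ j]) auto
    next
      case False
      then have "even (a - v)" using a by (simp add: parity_beats_def)
      then obtain j where "a - v = 2 * j" by (elim evenE)
      then show ?thesis using a False assms by (intro image_eqI[of _ _ "d - j"]) auto
    qed
  qed
  then have "card {a \<in> {l..<l + m}. a \<noteq> v \<and> parity_beats a v} \<le> card {..<d}"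
    by (rule surj_card_le[OF finite_lessThan])
  then show ?thesis by simp
qed

lemma f_one_complete_graph:
  assumes "k \<ge> 1"
  shows "f_one 2 {..<4 * k - 2} {e. e \<subseteq> {..<4 * k - 2} \<and> card e = 2} k = 0"
proof -
  define m where "m = 2 * (k - 1) + 1"
  define V where "V = {..<4 * k - 2}"
  define E where "E = {e. e \<subseteq> V \<and> card e = 2}"
  \<comment> \<open>Since \<open>4 * k - 2 = 2 * m\<close>, the vertices split into two blocks of
    odd length \<open>m\<close>; \<open>0..<0 + m\<close> keeps the shape \<open>l..<l + m\<close>
    of the counting lemmas.\<close>
  have V: "V = {0..<0 + m} \<union> {m..<m + m}" using assms by (auto simp: V_def m_def)
  define P where "P a b \<longleftrightarrow> (if a < m \<longleftrightarrow> b < m then parity_beats a b else a < m)" for a b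
  have "P a b \<or> P b a" if "a \<noteq> b" for a b
    using that by (auto simp: P_def parity_beats_def ac_simps)
  then obtain D where D: "orientation 2 E D"
    "\<And>v. pos_degree E D 1 v \<le> card {b \<in> V. b \<noteq> v \<and> P v b}"
    "\<And>v. pos_degree E D 2 v \<le> card {a \<in> V. a \<noteq> v \<and> P a v}"
    using tournament_orientation[of V P] unfolding E_def V_def by blast
  have "\<exists>i\<in>{1..2}. pos_degree E D i v < k" if "v \<in> V" for v
  proof (cases "v < m")
    case True
    \<comment> \<open>Cross edges leave the first block, so its vertices are beaten only from
      within; dually, vertices of the second block beat only within.\<close>
    then have "{a \<in> V. a \<noteq> v \<and> P a v} = {a \<in> {0..<0 + m}. a \<noteq> v \<and> parity_beats a v}"
      unfolding V by (auto simp: P_def split: if_splits)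
    then have "pos_degree E D 2 v \<le> k - 1"
      using D(3)[of v] card_parity_beating[of m "k - 1" 0 v] True by (simp add: m_def)
    then show ?thesis using assms by (intro bexI[of _ 2]) auto
  next
    case False
    then have "{b \<in> V. b \<noteq> v \<and> P v b} = {b \<in> {m..<m + m}. b \<noteq> v \<and> parity_beats v b}"
      unfolding V by (auto simp: P_def split: if_splits)
    moreover have "v < m + m" using that V by auto
    ultimately have "pos_degree E D 1 v \<le> k - 1"
      using D(2)[of v] card_parity_beaten_by[of m "k - 1" m v] False by (simp add: m_def)
    then show ?thesis using assms by (intro bexI[of _ 1]) auto
  qed
  then have "{v \<in> V. \<forall>i\<in>{1..2}. k \<le> pos_degree E D i v} = {}" by (auto simp: not_le[symmetric])
  then have "0 = card {v \<in> V. \<forall>i\<in>{1..2}. k \<le> pos_degree E D i v}" by (simp only: card.empty)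
  with D(1) have "f_one 2 V E k \<le> 0"
    unfolding f_one_def by (intro Least_le exI[of _ D] conjI)
  then show ?thesis by (simp add: V_def E_def)
qed

theorem theorem6:
  fixes k :: nat
  assumes "k \<ge> 1"
  shows "(\<forall>r n (V :: 'a set) E. r \<ge> 2 \<and> uniform_hypergraph r V E \<and> card V = n \<longrightarrow>
            int (f_one r V E k) \<ge> int (chromatic_number V E) - int r * (int r * (int k - 1) + 1))
       \<and> (\<exists>(V :: nat set) E. uniform_hypergraph 2 V E \<and>
            int (f_one 2 V E k) = int (chromatic_number V E) - 2 * (2 * (int k - 1) + 1))"
proof (intro conjI allI impI)
  fix r n and V :: "'a set" and E
  assume H: "r \<ge> 2 \<and> uniform_hypergraph r V E \<and> card V = n"
  then obtain D where D: "orientation r E D"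
    "f_one r V E k = card {v \<in> V. \<forall>i\<in>{1..r}. k \<le> pos_degree E D i v}"
    using f_one_attained by blast
  have "chromatic_number V E \<le> r * (r * (k - 1) + 1) + f_one r V E k"
    unfolding D(2) using chromatic_number_le_rich_vertices[OF assms _ _ D(1)] H by blast
  then have "int (chromatic_number V E) \<le> int (r * (r * (k - 1) + 1) + f_one r V E k)"
    by (rule zle_int[THEN iffD2])
  then show "int (f_one r V E k)
      \<ge> int (chromatic_number V E) - int r * (int r * (int k - 1) + 1)"
    \<comment> \<open>By \<open>k \<ge> 1\<close> the truncated difference \<open>k - 1\<close>
      agrees with \<open>int k - 1\<close>.\<close>
    using assms by (simp add: of_nat_diff distrib_left)
next
  let ?V = "{..<4 * k - 2}" and ?E = "{e. e \<subseteq> {..<4 * k - 2} \<and> card e = 2}"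
  have "uniform_hypergraph 2 ?V ?E" by (simp add: uniform_hypergraph_def)
  \<comment> \<open>Both sides are 0: the chromatic number \<open>4 * k - 2\<close> equals the
    subtracted term.\<close>
  moreover have "int (f_one 2 ?V ?E k) = int (chromatic_number ?V ?E) - 2 * (2 * (int k - 1) + 1)"
    using assms by (simp add: f_one_complete_graph chromatic_number_complete_graph of_nat_diff)
  ultimately show "\<exists>(V :: nat set) E. uniform_hypergraph 2 V E \<and>
      int (f_one 2 V E k) = int (chromatic_number V E) - 2 * (2 * (int k - 1) + 1)" by blast
qed

end
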